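(* Let $\mathbb{A}$ and $\mathbb{B}$ be two tensors of order $m\ge 3$ and dimension $n$. If $\mathbb{A}$ and $\mathbb{B}$ are similar, then their zero patterns $Z(\mathbb{A})$ and $Z(\mathbb{B})$ are permutational similar.
   Context: Write $[n]=\{1,\ldots,n\}$. An order $m$ dimension $n$ tensor $\mathbb{A}=(a_{i_1i_2\ldots i_m})$ is a multidimensional array of complex numbers $a_{i_1\ldots i_m}$ indexed by $i_1,\ldots,i_m\in[n]$. The unit tensor of order $m$ and dimension $n$ is $\mathbb{I}=(\delta_{i_1\ldots i_m})$ with $\delta_{i_1\ldots i_m}=1$ if $i_1=\cdots=i_m$ and $0$ otherwise. For complex matrices $P=(p_{ij}),Q=(q_{ij})$ of order $n$ and a tensor $\mathbb{A}$ of order $m$ and dimension $n$, the product $P\mathbb{A}Q$ is the order $m$ dimension $n$ tensor with entries $$(P\mathbb{A}Q)_{i_1\ldots i_m}=\sum_{j_1,\ldots,j_m=1}^n p_{i_1j_1}a_{j_1j_2\ldots j_m}q_{j_2i_2}\cdots q_{j_mi_m}.$$ Let $\mathbb{A},\mathbb{B}$ be order $m$ dimension $n$ tensors. They are similar if there exist matrices $P,Q$ of order $n$ with $P\mathbb{I}Q=\mathbb{I}$ and $\mathbb{B}=P\mathbb{A}Q$. They are permutational similar if $\mathbb{B}=P\mathbb{A}P^T$ for some permutation matrix $P$ of order $n$. The zero pattern $Z(\mathbb{A})$ is the tensor obtained from $\mathbb{A}$ by replacing every nonzero entry by $1$ (zero entries remain $0$). *)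

theory Defs
  imports "HOL-Analysis.Analysis"
begin

text \<open>
  The index set \<open>[n]\<close> is a finite type \<open>'n\<close>. An order \<open>m\<close> tensor is a function on index
  lists \<open>[i\<^sub>1, \<dots>, i\<^sub>m]\<close>; values at lists of length other than \<open>m\<close> are not entries and are
  normalised to \<open>0\<close> in \<open>tensors m\<close>, so that equality of functions is equality of tensors.
  List positions start at \<open>0\<close>, so \<open>ix ! k\<close> is the index \<open>i\<close> with subscript \<open>k + 1\<close>.
\<close>

type_synonym 'n tensor = "'n list \<Rightarrow> complex"

definition tensors :: "nat \<Rightarrow> 'n::finite tensor set" where
  "tensors m = {A. \<forall>ix. length ix \<noteq> m \<longrightarrow> A ix = 0}"

definition unit_tensor :: "nat \<Rightarrow> 'n::finite tensor" where
  "unit_tensor m = (\<lambda>ix. if length ix = m \<and> (\<forall>k<m. \<forall>l<m. ix ! k = ix ! l) then 1 else 0)"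

definition tensor_product ::
  "nat \<Rightarrow> complex^'n^'n \<Rightarrow> 'n::finite tensor \<Rightarrow> complex^'n^'n \<Rightarrow> 'n tensor" where
  "tensor_product m P A Q = (\<lambda>ix. if length ix = m
     then (\<Sum>jx | length jx = m.
             P $ (ix ! 0) $ (jx ! 0) * A jx * (\<Prod>k=1..<m. Q $ (jx ! k) $ (ix ! k)))
     else 0)"

definition similar_tensors :: "nat \<Rightarrow> 'n::finite tensor \<Rightarrow> 'n tensor \<Rightarrow> bool" where
  "similar_tensors m A B \<longleftrightarrow>
     (\<exists>P Q. tensor_product m P (unit_tensor m) Q = unit_tensor m \<and> B = tensor_product m P A Q)"

definition permutation_matrix :: "complex^'n^'n::finite \<Rightarrow> bool" where
  "permutation_matrix P \<longleftrightarrow>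
     (\<exists>\<sigma>. \<sigma> permutes UNIV \<and> P = (\<chi> i j. if j = \<sigma> i then 1 else 0))"

definition permutational_similar_tensors :: "nat \<Rightarrow> 'n::finite tensor \<Rightarrow> 'n tensor \<Rightarrow> bool" where
  "permutational_similar_tensors m A B \<longleftrightarrow>
     (\<exists>P. permutation_matrix P \<and> B = tensor_product m P A (transpose P))"

definition zero_pattern :: "'n::finite tensor \<Rightarrow> 'n tensor" where
  "zero_pattern A = (\<lambda>ix. if A ix = 0 then 0 else 1)"

end

theory Submission
  imports Defs
begin

text \<open>
  Let \<open>R\<close> be the entrywise power \<open>R\<^sub>j\<^sub>a = Q\<^sub>j\<^sub>a ^ (m - 1)\<close>. The condition
  \<open>P I Q = I\<close>, read at the indices \<open>(i, a, \<dots>, a)\<close>, says that \<open>P R\<close> is the identity matrix, so \<open>P\<close>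
  is invertible with inverse \<open>R\<close>. Read at \<open>(i, a, b, \<dots>, b)\<close> with \<open>a \<noteq> b\<close>, which is possible
  because \<open>m \<ge> 3\<close>, it says that \<open>P\<close> annihilates the vector with entries
  \<open>Q\<^sub>j\<^sub>a Q\<^sub>j\<^sub>b ^ (m - 2)\<close>. That vector is therefore zero: two distinct entries in one row of \<open>Q\<close>
  cannot both be nonzero. Since \<open>R\<close> is invertible, no row or column of \<open>Q\<close> vanishes, so the
  support of \<open>Q\<close> is the graph of a permutation, and the support of \<open>P = R\<inverse>\<close> is the transposed
  graph (lemma \<open>unit_preserving_pair_is_monomial\<close>).

  With such supports the sum that defines an entry of \<open>P A Q\<close> has a single surviving term, an
  entry of \<open>A\<close> at permuted indices times a nonzero scalar
  (lemma \<open>tensor_product_monomial\<close>). The scalars disappear in the zero pattern, and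
  the permutation of the indices remains.
\<close>

lemma finite_lists_of_length: "finite {jx :: 'n::finite list. length jx = m}"
  using finite_lists_length_eq[of "UNIV :: 'n set" m] by simp

lemma unit_tensor_eq_0:
  assumes "k < m" "l < m" "ix ! k \<noteq> ix ! l"
  shows "unit_tensor m ix = 0"
  using assms by (auto simp: unit_tensor_def)

text \<open>
  Only constant index lists carry a nonzero entry of the unit tensor, so the \<open>m\<close>-fold sum
  collapses to a sum over one index.
\<close>

lemma tensor_product_unit_tensor:
  fixes P Q :: "complex^'n^'n::finite"
  shows "tensor_product (Suc (length ix)) P (unit_tensor (Suc (length ix))) Q (i # ix)
       = (\<Sum>j\<in>UNIV. P $ i $ j * (\<Prod>a\<leftarrow>ix. Q $ j $ a))"
proof -
  let ?m = "Suc (length ix)"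
  let ?f = "\<lambda>jx. P $ i $ (jx ! 0) * unit_tensor ?m jx *
    (\<Prod>k=1..<?m. Q $ (jx ! k) $ ((i # ix) ! k))"
  let ?C = "range (\<lambda>j::'n. replicate ?m j)"
  have inj: "inj (\<lambda>j::'n. replicate ?m j)"
    by (auto simp: inj_def)
  have "tensor_product ?m P (unit_tensor ?m) Q (i # ix) = sum ?f {jx. length jx = ?m}"
    by (simp add: tensor_product_def)
  also have "\<dots> = sum ?f ?C"
  proof (rule sum.mono_neutral_right)
    show "finite {jx :: 'n list. length jx = ?m}"
      by (rule finite_lists_of_length)
    show "?C \<subseteq> {jx. length jx = ?m}"
      by auto
    show "\<forall>jx\<in>{jx. length jx = ?m} - ?C. ?f jx = 0"
    proof
      fix jx :: "'n list"
      assume jx: "jx \<in> {jx. length jx = ?m} - ?C"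
      have "\<exists>k<?m. jx ! k \<noteq> jx ! 0"
      proof (rule ccontr)
        assume const: "\<not> (\<exists>k<?m. jx ! k \<noteq> jx ! 0)"
        have "jx = replicate ?m (jx ! 0)"
        proof (rule nth_equalityI)
          show "length jx = length (replicate ?m (jx ! 0))"
            using jx by simp
          fix k assume "k < length jx"
          hence "k < ?m"
            using jx by simp
          thus "jx ! k = replicate ?m (jx ! 0) ! k"
            using const nth_replicate by metis
        qed
        with jx show False
          by blast
      qed
      hence "unit_tensor ?m jx = 0"
        using unit_tensor_eq_0[of _ ?m 0 jx] by blast
      thus "?f jx = 0"
        by simp
    qed
  qed
  also have "\<dots> = (\<Sum>j\<in>UNIV. ?f (replicate ?m j))"
    using sum.reindex[OF inj, of ?f] by (simp only: o_def)
  also have "\<dots> = (\<Sum>j\<in>UNIV. P $ i $ j * (\<Prod>a\<leftarrow>ix. Q $ j $ a))"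
  proof (rule sum.cong[OF refl])
    fix j :: 'n
    have "(\<Prod>k=1..<?m. Q $ (replicate ?m j ! k) $ ((i # ix) ! k))
        = (\<Prod>k=1..<?m. Q $ j $ ((i # ix) ! k))"
      by (intro prod.cong) (auto simp del: replicate_Suc)
    also have "\<dots> = (\<Prod>k=0..<length ix. Q $ j $ (ix ! k))"
      using prod.shift_bounds_Suc_ivl[of "\<lambda>k. Q $ j $ ((i # ix) ! k)" 0 "length ix"] by simp
    also have "\<dots> = (\<Prod>a\<leftarrow>ix. Q $ j $ a)"
      by (simp add: prod.list_conv_set_nth)
    finally have "(\<Prod>k=1..<?m. Q $ (replicate ?m j ! k) $ ((i # ix) ! k)) = (\<Prod>a\<leftarrow>ix. Q $ j $ a)" .
    moreover have "unit_tensor ?m (replicate ?m j) = 1"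
      by (simp add: unit_tensor_def del: replicate_Suc)
    ultimately show "?f (replicate ?m j) = P $ i $ j * (\<Prod>a\<leftarrow>ix. Q $ j $ a)"
      by simp
  qed
  finally show ?thesis .
qed

text \<open>
  The condition \<open>m \<ge> 3\<close> provides two column slots besides the row slot, and this is what forces
  distinct columns of \<open>Q\<close> to have disjoint supports. For \<open>m = 2\<close> the hypothesis only says
  that \<open>P\<close> and \<open>Q\<close> are inverse to each other.
\<close>

lemma unit_preserving_pair_is_monomial:
  fixes P Q :: "complex^'n^'n::finite"
  assumes m: "m \<ge> 3"
    and unit: "tensor_product m P (unit_tensor m) Q = unit_tensor m"
  shows "\<exists>\<sigma>. \<sigma> permutes UNIV \<and> (\<forall>i j. P $ i $ j \<noteq> 0 \<longleftrightarrow> j = \<sigma> i) \<and>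
             (\<forall>i j. Q $ j $ i \<noteq> 0 \<longleftrightarrow> j = \<sigma> i)"
proof -
  obtain n where n: "m = Suc (Suc (Suc n))"
    using m by (metis le_Suc_ex numeral_3_eq_3 add_Suc add_0)
  define R :: "complex^'n^'n" where "R = (\<chi> j a. (Q $ j $ a) ^ Suc (Suc n))"
  have entry: "(\<Sum>j\<in>UNIV. P $ i $ j * (\<Prod>a\<leftarrow>ix. Q $ j $ a)) = unit_tensor m (i # ix)"
    if "length ix = Suc (Suc n)" for i ix
    using tensor_product_unit_tensor[where ix = ix and P = P and Q = Q and i = i] unit that n
    by simp
  have PR: "P ** R = mat 1"
  proof -
    have "(\<Sum>j\<in>UNIV. P $ i $ j * R $ j $ a) = (if i = a then 1 else 0)" for i a
    proof -
      have "(\<Sum>j\<in>UNIV. P $ i $ j * R $ j $ a) = unit_tensor m (i # replicate (Suc (Suc n)) a)"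
        using entry[of "replicate (Suc (Suc n)) a" i] by (simp add: R_def)
      also have "\<dots> = (if i = a then 1 else 0)"
      proof (cases "i = a")
        case True
        hence "i # replicate (Suc (Suc n)) a = replicate m a"
          using n by simp
        thus ?thesis
          using True by (simp add: unit_tensor_def del: replicate_Suc)
      next
        case False
        hence "(i # replicate (Suc (Suc n)) a) ! 0 \<noteq> (i # replicate (Suc (Suc n)) a) ! 1"
          by simp
        moreover have "0 < m" "1 < m"
          using n by auto
        ultimately have "unit_tensor m (i # replicate (Suc (Suc n)) a) = 0"
          using unit_tensor_eq_0 by blast
        thus ?thesis
          using False by simp
      qed
      finally show ?thesis .
    qed
    thus ?thesis
      by (simp add: vec_eq_iff matrix_matrix_mult_def mat_def)
  qed
  \<comment> \<open>Both matrices are square, so \<open>R\<close> is a two-sided inverse of \<open>P\<close>.\<close>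
  hence RP: "R ** P = mat 1"
    by (simp add: matrix_left_right_inverse)
  have disjoint: "Q $ j $ a = 0 \<or> Q $ j $ b = 0" if "a \<noteq> b" for j a b
  proof -
    define v :: "complex^'n" where "v = (\<chi> j. Q $ j $ a * (Q $ j $ b) ^ Suc n)"
    have "(\<Sum>j\<in>UNIV. P $ i $ j * v $ j) = 0" for i
    proof -
      let ?ix = "i # a # replicate (Suc n) b"
      have "(\<Sum>j\<in>UNIV. P $ i $ j * v $ j) = unit_tensor m ?ix"
        using entry[of "a # replicate (Suc n) b" i] by (simp add: v_def)
      moreover have "?ix ! 1 \<noteq> ?ix ! 2" "1 < m" "2 < m"
        using that n by auto
      hence "unit_tensor m ?ix = 0"
        using unit_tensor_eq_0 by blast
      ultimately show ?thesis
        by simp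
    qed
    hence "P *v v = 0"
      by (simp add: vec_eq_iff matrix_vector_mult_def)
    hence "v = 0"
      by (metis RP matrix_vector_mul_assoc matrix_vector_mul_lid matrix_vector_mult_0_right)
    hence "v $ j = 0"
      by simp
    thus ?thesis
      by (auto simp: v_def)
  qed
  have row: "\<exists>a. Q $ j $ a \<noteq> 0" for j
  proof (rule ccontr)
    assume "\<not> (\<exists>a. Q $ j $ a \<noteq> 0)"
    hence "(R ** P) $ j $ j = 0"
      by (simp add: matrix_matrix_mult_def R_def)
    thus False
      by (simp add: RP mat_def)
  qed
  have column: "\<exists>j. Q $ j $ a \<noteq> 0" for a
  proof (rule ccontr)
    assume "\<not> (\<exists>j. Q $ j $ a \<noteq> 0)"
    hence "(P ** R) $ a $ a = 0"
      by (simp add: matrix_matrix_mult_def R_def)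
    thus False
      by (simp add: PR mat_def)
  qed
  obtain \<tau> where "\<forall>j. Q $ j $ \<tau> j \<noteq> 0"
    using row by metis
  hence Q_\<tau>: "Q $ j $ a \<noteq> 0 \<longleftrightarrow> a = \<tau> j" for j a
    using disjoint by metis
  have "surj \<tau>"
    using column Q_\<tau> by (metis surjI)
  hence bij: "bij \<tau>"
    by (simp add: bij_def finite_UNIV_surj_inj)
  have P_\<tau>: "P $ \<tau> j $ k \<noteq> 0 \<longleftrightarrow> k = j" for j k
  proof -
    have "(if j = k then 1 else 0) = (R ** P) $ j $ k"
      by (simp add: RP mat_def)
    also have "\<dots> = (\<Sum>a\<in>UNIV. R $ j $ a * P $ a $ k)"
      by (simp add: matrix_matrix_mult_def)
    also have "\<dots> = (\<Sum>a\<in>{\<tau> j}. R $ j $ a * P $ a $ k)"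
      using Q_\<tau>[of j] by (intro sum.mono_neutral_right) (auto simp: R_def)
    finally have "R $ j $ \<tau> j * P $ \<tau> j $ k = (if j = k then 1 else 0)"
      by simp
    moreover have "R $ j $ \<tau> j \<noteq> 0"
      using Q_\<tau>[of j "\<tau> j"] by (simp add: R_def)
    ultimately show ?thesis
      by (auto split: if_splits)
  qed
  have inv: "j = inv \<tau> i \<longleftrightarrow> i = \<tau> j" for i j
    using bij by (metis bij_inv_eq_iff)
  have "inv \<tau> permutes UNIV"
    using bij_imp_bij_inv[OF bij] by (intro bij_imp_permutes) auto
  moreover have "P $ i $ j \<noteq> 0 \<longleftrightarrow> j = inv \<tau> i" for i j
    using P_\<tau>[of "inv \<tau> i" j] inv[of "inv \<tau> i" i] by simp
  moreover have "Q $ j $ i \<noteq> 0 \<longleftrightarrow> j = inv \<tau> i" for i j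
    using Q_\<tau> inv by simp
  ultimately show ?thesis
    by blast
qed

text \<open>
  A term of the sum that defines an entry at \<open>ix\<close> survives only if each summation index is the
  image under \<open>\<sigma>\<close> of the corresponding index of \<open>ix\<close>.
\<close>

lemma tensor_product_monomial:
  fixes P Q :: "complex^'n^'n::finite"
  assumes P: "\<And>i j. j \<noteq> \<sigma> i \<Longrightarrow> P $ i $ j = 0"
    and Q: "\<And>i j. j \<noteq> \<sigma> i \<Longrightarrow> Q $ j $ i = 0"
    and m: "length ix = m" "m > 0"
  shows "tensor_product m P A Q ix =
    P $ (ix ! 0) $ \<sigma> (ix ! 0) * A (map \<sigma> ix) * (\<Prod>k=1..<m. Q $ \<sigma> (ix ! k) $ (ix ! k))"
proof -
  let ?f = "\<lambda>jx. P $ (ix ! 0) $ (jx ! 0) * A jx * (\<Prod>k=1..<m. Q $ (jx ! k) $ (ix ! k))"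
  have "tensor_product m P A Q ix = sum ?f {jx. length jx = m}"
    using m by (simp add: tensor_product_def)
  also have "\<dots> = sum ?f {map \<sigma> ix}"
  proof (rule sum.mono_neutral_right)
    show "finite {jx :: 'n list. length jx = m}"
      by (rule finite_lists_of_length)
    show "{map \<sigma> ix} \<subseteq> {jx. length jx = m}"
      using m by simp
    show "\<forall>jx\<in>{jx. length jx = m} - {map \<sigma> ix}. ?f jx = 0"
    proof
      fix jx assume "jx \<in> {jx. length jx = m} - {map \<sigma> ix}"
      hence "length jx = m" "jx \<noteq> map \<sigma> ix"
        by auto
      then obtain k where k: "k < m" "jx ! k \<noteq> \<sigma> (ix ! k)"
        using m(1) by (metis length_map nth_equalityI nth_map)
      show "?f jx = 0"
      proof (cases "k = 0")
        case True
        thus ?thesis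
          using P k by simp
      next
        case False
        hence "(\<Prod>k=1..<m. Q $ (jx ! k) $ (ix ! k)) = 0"
          using k by (intro prod_zero) (auto intro!: bexI[of _ k] Q)
        thus ?thesis
          by simp
      qed
    qed
  qed
  also have "\<dots> = P $ (ix ! 0) $ \<sigma> (ix ! 0) * A (map \<sigma> ix) *
      (\<Prod>k=1..<m. Q $ \<sigma> (ix ! k) $ (ix ! k))"
    using m by simp
  finally show ?thesis .
qed

theorem theorem3p2:
  fixes A B :: "'n::finite tensor" and m :: nat
  assumes "m \<ge> 3"
    and "A \<in> tensors m" and "B \<in> tensors m"
    and "similar_tensors m A B"
  shows "permutational_similar_tensors m (zero_pattern A) (zero_pattern B)"
proof -
  obtain P Q where unit: "tensor_product m P (unit_tensor m) Q = unit_tensor m"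
    and B: "B = tensor_product m P A Q"
    using assms(4) by (auto simp: similar_tensors_def)
  obtain \<sigma> where \<sigma>: "\<sigma> permutes UNIV"
    and P: "\<And>i j. P $ i $ j \<noteq> 0 \<longleftrightarrow> j = \<sigma> i" and Q: "\<And>i j. Q $ j $ i \<noteq> 0 \<longleftrightarrow> j = \<sigma> i"
    using unit_preserving_pair_is_monomial[OF assms(1) unit] by blast
  define S :: "complex^'n^'n" where "S = (\<chi> i j. if j = \<sigma> i then 1 else 0)"
  have "zero_pattern B ix = tensor_product m S (zero_pattern A) (transpose S) ix" for ix
  proof (cases "length ix = m")
    case True
    have m: "m > 0"
      using assms(1) by simp
    have "B ix = P $ (ix ! 0) $ \<sigma> (ix ! 0) * A (map \<sigma> ix) *
        (\<Prod>k=1..<m. Q $ \<sigma> (ix ! k) $ (ix ! k))"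
      unfolding B using P Q True m by (intro tensor_product_monomial) blast+
    moreover have "P $ (ix ! 0) $ \<sigma> (ix ! 0) \<noteq> 0"
      using P by blast
    moreover have "(\<Prod>k=1..<m. Q $ \<sigma> (ix ! k) $ (ix ! k)) \<noteq> 0"
      using Q by simp
    ultimately have "B ix = 0 \<longleftrightarrow> A (map \<sigma> ix) = 0"
      by simp
    hence "zero_pattern B ix = zero_pattern A (map \<sigma> ix)"
      by (simp add: zero_pattern_def)
    also have "\<dots> = tensor_product m S (zero_pattern A) (transpose S) ix"
      using True m
      by (subst tensor_product_monomial[where \<sigma> = \<sigma>]) (auto simp: S_def transpose_def)
    finally show ?thesis .
  next
    case False
    thus ?thesis
      by (simp add: B zero_pattern_def tensor_product_def)
  qed
  moreover have "permutation_matrix S"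
    using \<sigma> by (auto simp: permutation_matrix_def S_def)
  ultimately show ?thesis
    unfolding permutational_similar_tensors_def by blast
qed

end
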